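(* Let $n\ge 1$ and $C\ge 2$ be integers, and let $f=(f_1,\dots,f_C):\mathbb{R}^n\to\mathbb{R}^C$ satisfy $f_i(x)\ge 0$ for all $i\in\{1,\dots,C\}$ and all $x\in\mathbb{R}^n$. Suppose $f$ is $\ell_\infty/\ell_2$ Lipschitz continuous with parameter $L_\infty>0$. Let $x\in\mathbb{R}^n$ be such that its margin satisfies $\mu_f(x)>0$. Then the open ball $$\mathsf{B}_2\left(x,\frac{\mu_f(x)}{2L_\infty}\right)$$ is class pure, i.e., $\hat{c}(y)=\hat{c}(x)$ for every $y\in \mathsf{B}_2\left(x,\frac{\mu_f(x)}{2L_\infty}\right)$.
   Context: The function $f$ models a classifier with $C$ classes. The class decision for an input $x\in\mathbb{R}^n$ is $\hat{c}(x)=\arg\max_{i\in\{1,\dots,C\}} f_i(x)$, where the class is chosen arbitrarily among the maximizing indices in case of ties. The margin of $x$ is $$\mu_f(x):=f_{\hat{c}(x)}(x)-\max_{i\neq \hat{c}(x)} f_i(x)\ \ge 0.$$ The function $f$ is $\ell_\infty/\ell_2$ Lipschitz continuous with parameter $L_\infty$ if $L_\infty$ is the smallest positive number satisfying $$|f(x)-f(y)|_\infty\le L_\infty|x-y|_2\quad\text{for all }x,y\in\mathbb{R}^n,$$ where $|\cdot|_\infty$ is the max norm on $\mathbb{R}^C$ and $|\cdot|_2$ is the Euclidean norm on $\mathbb{R}^n$. For $\varepsilon>0$, $\mathsf{B}_2(x,\varepsilon):=\{z\in\mathbb{R}^n : |x-z|_2<\varepsilon\}$. A ball centered at $x$ is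 class pure if every point in it is assigned the same class decision as $x$ (whatever the tie-breaking choice). *)

theory Defs
  imports "HOL-Analysis.Analysis"
begin

text \<open>
  A classifier with \<open>C = CARD('c)\<close> classes on \<open>n\<close>-dimensional space, \<open>n = CARD('n)\<close>, is a
  function \<open>f :: real^'n \<Rightarrow> real^'c\<close>; \<open>f x $ i\<close> is the score of class \<open>i\<close> at \<open>x\<close>.
  Ties may be broken arbitrarily, and differently at each point, so a class decision is any
  function \<open>c\<close> that picks a maximizing index everywhere.
\<close>

definition class_decision :: "(real^'n \<Rightarrow> real^'c) \<Rightarrow> (real^'n \<Rightarrow> 'c) \<Rightarrow> bool" where
  "class_decision f c \<longleftrightarrow> (\<forall>x. is_arg_max (\<lambda>i. f x $ i) (\<lambda>i. i \<in> UNIV) (c x))"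

text \<open>The \<open>Max\<close> is over a nonempty set only if there are at least two classes.\<close>

definition margin :: "(real^'n \<Rightarrow> real^'c) \<Rightarrow> (real^'n \<Rightarrow> 'c) \<Rightarrow> real^'n \<Rightarrow> real" where
  "margin f c x = f x $ c x - Max ((\<lambda>i. f x $ i) ` {i. i \<noteq> c x})"

definition linf_l2_bound :: "(real^'n \<Rightarrow> real^'c) \<Rightarrow> real \<Rightarrow> bool" where
  "linf_l2_bound f L \<longleftrightarrow> (\<forall>x y. infnorm (f x - f y) \<le> L * norm (x - y))"

text \<open>
  The parameter is the least \<^emph>\<open>positive\<close> bound; a constant function therefore has none.
\<close>

definition linf_l2_lipschitz :: "(real^'n \<Rightarrow> real^'c) \<Rightarrow> real \<Rightarrow> bool" where
  "linf_l2_lipschitz f L \<longleftrightarrow>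
     0 < L \<and> linf_l2_bound f L \<and> (\<forall>M>0. linf_l2_bound f M \<longrightarrow> L \<le> M)"

text \<open>Purity is required for every tie-breaking choice \<open>d\<close>.\<close>

definition class_pure_ball :: "(real^'n \<Rightarrow> real^'c) \<Rightarrow> real^'n \<Rightarrow> real \<Rightarrow> bool" where
  "class_pure_ball f x r \<longleftrightarrow> (\<forall>d. class_decision f d \<longrightarrow> (\<forall>y\<in>ball x r. d y = d x))"

end

theory Submission
  imports Defs
begin

text \<open>Moving from \<open>x\<close> to \<open>y\<close> changes every score by at most
  \<open>L * norm (x - y)\<close>, which inside the ball is less than half the margin. The lead of
  class \<open>c x\<close> over any rival is at least the margin at \<open>x\<close> and shrinks by
  less than that, so it stays positive (\<open>component_less_in_margin_ball\<close>). Thus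
  \<open>c x\<close> is the unique maximizer throughout the ball, and tie-breaking cannot matter
  there.\<close>

lemma margin_le_diff:
  assumes "i \<noteq> c x"
  shows "margin f c x \<le> f x $ c x - f x $ i"
proof -
  have "f x $ i \<le> Max ((\<lambda>i. f x $ i) ` {i. i \<noteq> c x})"
    using assms by (intro Max_ge) auto
  then show ?thesis
    by (simp add: margin_def)
qed

lemma linf_l2_bound_component:
  assumes "linf_l2_bound f L"
  shows "\<bar>f x $ i - f y $ i\<bar> \<le> L * norm (x - y)"
proof -
  have "\<bar>f x $ i - f y $ i\<bar> \<le> infnorm (f x - f y)"
    using component_le_infnorm_cart[of "f x - f y" i] by simp
  also have "\<dots> \<le> L * norm (x - y)"
    using assms by (simp add: linf_l2_bound_def)
  finally show ?thesis .
qed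

lemma component_less_in_margin_ball:
  assumes bound: "linf_l2_bound f L" and "0 < L"
    and y: "y \<in> ball x (margin f c x / (2 * L))" and i: "i \<noteq> c x"
  shows "f y $ i < f y $ c x"
proof -
  \<comment> \<open>The factor 2 pays for two changes: the score of \<open>c x\<close> may drop
    while that of \<open>i\<close> rises.\<close>
  have "2 * (L * norm (x - y)) < margin f c x"
    using y \<open>0 < L\<close> by (simp add: dist_norm field_simps)
  also have "\<dots> \<le> f x $ c x - f x $ i"
    using i by (rule margin_le_diff)
  finally show ?thesis
    using linf_l2_bound_component[OF bound, of x i y]
      linf_l2_bound_component[OF bound, of x "c x" y]
    by linarith
qed

text \<open>A strict maximizer leaves no tie to break.\<close>

lemma class_decision_eqI:
  assumes "class_decision f d" and "\<And>i. i \<noteq> j \<Longrightarrow> f y $ i < f y $ j"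
  shows "d y = j"
  using assms unfolding class_decision_def is_arg_max_def by blast

theorem mainTheorem1:
  fixes f :: "real^'n \<Rightarrow> real^'c"
    and c :: "real^'n \<Rightarrow> 'c"
    and L :: real
    and x :: "real^'n"
  assumes "CARD('c) \<ge> 2"
    and "\<And>i z. 0 \<le> f z $ i"
    and "linf_l2_lipschitz f L"
    and "class_decision f c"
    and "margin f c x > 0"
  shows "class_pure_ball f x (margin f c x / (2 * L))"
  unfolding class_pure_ball_def
proof (intro allI impI ballI)
  fix d y
  assume d: "class_decision f d" and y: "y \<in> ball x (margin f c x / (2 * L))"
  have L: "linf_l2_bound f L" "0 < L"
    using assms(3) by (auto simp: linf_l2_lipschitz_def)
  \<comment> \<open>\<open>d\<close> and \<open>c\<close> may break ties differently, so
    \<open>d y\<close> and \<open>d x\<close> are each compared with \<open>c x\<close>.\<close>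
  have eq: "d z = c x" if "z \<in> ball x (margin f c x / (2 * L))" for z
    using d component_less_in_margin_ball[OF L that] by (rule class_decision_eqI)
  \<comment> \<open>The positive margin makes the radius positive, so \<open>eq\<close> also applies
    at the centre.\<close>
  have "x \<in> ball x (margin f c x / (2 * L))"
    using assms(5) L(2) by simp
  then show "d y = d x"
    using eq y by simp
qed

end
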